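(* Let $n\ge 1$ and $l\ge 0$ be integers and let $0\le d<\pi/2$. Then $$\int_d^{\pi/2}\frac{\sqrt{\cos^2(d)-\cos^2(u)}}{\cos^2(d)}\,L^{2n}\left(C^1_{2l+2n}(\cos(u))\right)\sin(u)\,du=\frac{2^{2n-2}\,\pi\,(l+2n)!}{(l+1)!}\,P_l^{(2n-1,1)}(\cos(2d)),$$ where $L=-\frac{1}{\sin(u)}\frac{d}{du}$ and $L^{2n}$ is its $2n$-fold composition.
   Context: $P_l^{(\alpha,\beta)}$ is the classical Jacobi polynomial of degree $l$, normalized by $P_l^{(\alpha,\beta)}(1)=\binom{l+\alpha}{l}$. $C_m^1$ is the Gegenbauer polynomial of degree $m$ satisfying $C_m^1(\cos\theta)=\frac{\sin((m+1)\theta)}{\sin\theta}$. The operator $L=-\frac{1}{\sin(u)}\frac{d}{du}$ acts on functions of $u$ (at $u=0$ the result is understood by continuous extension). *)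

theory Defs
  imports "HOL-Analysis.Analysis" "HOL-Computational_Algebra.Polynomial"
begin

(* Explicit classical formula (Szego, Orthogonal Polynomials, (4.3.2)), valid for all real
   parameters:
   P_l(x) = sum_s binom(l+a, l-s) binom(l+b, s) ((x-1)/2)^s ((x+1)/2)^(l-s). *)
definition jacobi_poly :: "real \<Rightarrow> real \<Rightarrow> nat \<Rightarrow> real poly" where
  "jacobi_poly \<alpha> \<beta> l =
     (\<Sum>s\<le>l. smult (((real l + \<alpha>) gchoose (l - s)) * ((real l + \<beta>) gchoose s))
              ([:- (1/2), 1/2:] ^ s * [:1/2, 1/2:] ^ (l - s)))"

lemma jacobi_poly_at_1: "poly (jacobi_poly \<alpha> \<beta> l) 1 = (real l + \<alpha>) gchoose l"
proof -
  have "poly (jacobi_poly \<alpha> \<beta> l) 1 =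
      (\<Sum>s\<le>l. if s = 0 then (real l + \<alpha>) gchoose l else 0)"
    unfolding jacobi_poly_def poly_sum
    by (intro sum.cong refl) (auto simp: poly_power)
  then show ?thesis by simp
qed

(* Three-term recurrence of the Gegenbauer polynomials:
   m C_m(x) = 2 (m + lam - 1) x C_(m-1)(x) - (m + 2 lam - 2) C_(m-2)(x), here at m + 2. *)
fun gegenbauer_poly :: "real \<Rightarrow> nat \<Rightarrow> real poly" where
  "gegenbauer_poly lam 0 = 1"
| "gegenbauer_poly lam (Suc 0) = [:0, 2 * lam:]"
| "gegenbauer_poly lam (Suc (Suc m)) =
     smult (1 / (real m + 2))
       (smult (2 * (real m + 1 + lam)) ([:0, 1:] * gegenbauer_poly lam (Suc m))
        - smult (real m + 2 * lam) (gegenbauer_poly lam m))"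

lemma gegenbauer_poly_1_rec:
  "gegenbauer_poly 1 (Suc (Suc m)) = [:0, 2:] * gegenbauer_poly 1 (Suc m) - gegenbauer_poly 1 m"
proof (rule poly_eqI)
  fix i
  show "coeff (gegenbauer_poly 1 (Suc (Suc m))) i =
      coeff ([:0, 2:] * gegenbauer_poly 1 (Suc m) - gegenbauer_poly 1 m) i"
    by (cases i) (simp_all del: gegenbauer_poly.simps(2) add: field_simps)
qed

lemma gegenbauer_poly_1_cos_mult_sin:
  "poly (gegenbauer_poly 1 m) (cos \<theta>) * sin \<theta> = sin (real (m + 1) * \<theta>)"
proof (induction m rule: induct_nat_012)
  case 0
  then show ?case by simp
next
  case 1
  then show ?case using sin_double[of \<theta>] by simp
next
  case (ge2 m)
  define t where "t = real (m + 2) * \<theta>"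
  have e: "real (m + 1) * \<theta> = t - \<theta>" "real (Suc m + 1) * \<theta> = t"
      "real (Suc (Suc m) + 1) * \<theta> = t + \<theta>"
    by (simp_all add: t_def algebra_simps)
  have "poly (gegenbauer_poly 1 (Suc (Suc m))) (cos \<theta>) * sin \<theta>
      = 2 * cos \<theta> * (poly (gegenbauer_poly 1 (Suc m)) (cos \<theta>) * sin \<theta>)
        - poly (gegenbauer_poly 1 m) (cos \<theta>) * sin \<theta>"
    unfolding gegenbauer_poly_1_rec by (simp add: algebra_simps)
  also have "\<dots> = 2 * cos \<theta> * sin t - sin (t - \<theta>)"
    using ge2 unfolding e by simp
  also have "\<dots> = sin (t + \<theta>)"
    by (simp add: sin_add sin_diff)
  finally show ?case unfolding e .
qed

lemma gegenbauer_poly_1_cos: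
  assumes "sin \<theta> \<noteq> 0"
  shows "poly (gegenbauer_poly 1 m) (cos \<theta>) = sin (real (m + 1) * \<theta>) / sin \<theta>"
  using gegenbauer_poly_1_cos_mult_sin[of m \<theta>] assms by (simp add: field_simps)

(* Zeros of sin are removable singularities for the functions of interest, and the value there
   is the one of the continuous extension. *)
definition L_op :: "(real \<Rightarrow> real) \<Rightarrow> real \<Rightarrow> real" where
  "L_op f u = (if sin u = 0 then Lim (at u) (\<lambda>v. - (1 / sin v) * deriv f v)
               else - (1 / sin u) * deriv f u)"

end

theory Submission
  imports Defs
begin

text \<open>
  On functions of \<open>x = cos u\<close> the operator \<open>L\<close> is differentiation with respect to \<open>x\<close>. Hence
  \<open>L\<^sup>2\<^sup>n C\<^sup>1\<^sub>m(cos u)\<close> with \<open>m = 2l + 2n\<close> is \<open>q(cos u)\<close>, where \<open>q\<close> is the \<open>2n\<close>-th derivative of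
  the polynomial \<open>C\<^sup>1\<^sub>m\<close>: an even polynomial of degree \<open>2l\<close>. Writing \<open>c = cos d\<close>, the integral is
  therefore a linear combination of the moments
  \[ \int_d^{\pi/2} \sqrt{c^2 - \cos^2 u}\, \cos^{2k} u\, \sin u\, du
     = \frac{\pi}{4} \frac{(2k)!}{k!\,(k+1)!\,4^k} c^{2k+2} \qquad (k \le l), \]
  that is, a polynomial in \<open>c\<^sup>2\<close>. The factor \<open>(2k)!\<close> cancels against the one that differentiation
  leaves in the denominator of the coefficient of \<open>x\<^sup>2\<^sup>k\<close> in \<open>q\<close>, and after the division by
  \<open>cos\<^sup>2 d = c\<^sup>2\<close> what remains is
  \[ 2^{2n-2} \pi \sum_{k \le l} (-1)^{l-k} \frac{(l+2n+k)!}{(l-k)!\,k!\,(k+1)!} c^{2k}. \]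
  On the other side \<open>cos (2d) = 2c\<^sup>2 - 1\<close>, so the Jacobi polynomial is needed in powers of
  \<open>y = (1 + x) / 2 = c\<^sup>2\<close>. Its expansion at \<open>x = -1\<close> (lemma \<open>poly_jacobi_poly_expansion\<close>) follows
  from the two-sided defining formula by Vandermonde's convolution, and agrees with the sum above
  term by term.
\<close>

section \<open>The operator L on polynomials in the cosine\<close>

text \<open>
  Where \<open>sin u \<noteq> 0\<close> this is the chain rule. A zero of \<open>sin\<close> is isolated, because the derivative
  \<open>cos\<close> does not vanish there; so the limit in the definition only sees points at which the chain
  rule applies, and continuity of \<open>p'(cos u)\<close> gives its value.
\<close>
lemma L_op_poly_cos:
  "L_op (\<lambda>v. poly p (cos v)) = (\<lambda>v. poly (pderiv p) (cos v))"
proof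
  fix u :: real
  have quotient: "- (1 / sin v) * deriv (\<lambda>v. poly p (cos v)) v = poly (pderiv p) (cos v)"
    if "sin v \<noteq> 0" for v
  proof -
    have "((\<lambda>v. poly p (cos v)) has_real_derivative poly (pderiv p) (cos v) * (- sin v)) (at v)"
      by (rule DERIV_chain'[OF DERIV_cos poly_DERIV, THEN DERIV_cong]) simp
    then show ?thesis using that by (simp add: DERIV_imp_deriv)
  qed
  show "L_op (\<lambda>v. poly p (cos v)) u = poly (pderiv p) (cos u)"
  proof (cases "sin u = 0")
    case True
    then have cos_nz: "cos u \<noteq> 0"
      using sin_cos_squared_add[of u] by auto
    have "((\<lambda>v. (sin v - sin u) / (v - u)) \<longlongrightarrow> cos u) (at u)"
      using DERIV_sin[of u] by (simp add: has_field_derivative_iff)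
    then have "eventually (\<lambda>v. (sin v - sin u) / (v - u) \<noteq> 0) (at u)"
      using cos_nz by (rule tendsto_imp_eventually_ne)
    then have ev: "eventually (\<lambda>v. poly (pderiv p) (cos v)
        = - (1 / sin v) * deriv (\<lambda>v. poly p (cos v)) v) (at u)"
      by (rule eventually_mono) (use quotient True in auto)
    have "((\<lambda>v. poly (pderiv p) (cos v)) \<longlongrightarrow> poly (pderiv p) (cos u)) (at u)"
      by (intro tendsto_intros)
    from this ev have
      "((\<lambda>v. - (1 / sin v) * deriv (\<lambda>v. poly p (cos v)) v) \<longlongrightarrow> poly (pderiv p) (cos u)) (at u)"
      by (rule Lim_transform_eventually)
    then show ?thesis
      using True by (simp add: L_op_def tendsto_Lim)
  next
    case False
    then show ?thesis using quotient by (simp add: L_op_def)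
  qed
qed

lemma funpow_L_op_poly_cos:
  "(L_op ^^ k) (\<lambda>v. poly p (cos v)) = (\<lambda>v. poly ((pderiv ^^ k) p) (cos v))"
  by (induction k) (simp_all add: L_op_poly_cos)

section \<open>Coefficients of the Gegenbauer polynomials with parameter 1\<close>

text \<open>
  The classical formula \<open>C\<^sup>1\<^sub>m(x) = (\<Sum>j. (-1)\<^sup>j (m - j choose j) (2x)\<^sup>m\<^sup>-\<^sup>2\<^sup>j)\<close>, solved for the
  exponent \<open>i = m - 2j\<close> so that the recurrence turns into Pascal's rule.
\<close>
lemma coeff_gegenbauer_poly_1:
  "coeff (gegenbauer_poly 1 m) i =
     (if i \<le> m \<and> even (m + i)
      then (-1) ^ ((m - i) div 2) * 2 ^ i * real (((m + i) div 2) choose ((m - i) div 2)) else 0)"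
proof (induction m arbitrary: i rule: induct_nat_012)
  case 0
  then show ?case by (auto simp: odd_pos)
next
  case 1
  show ?case
  proof (cases i)
    case (Suc j)
    then show ?thesis by (cases j) (auto simp: coeff_pCons)
  qed simp
next
  case (ge2 m)
  have rec: "coeff (gegenbauer_poly 1 (Suc (Suc m))) i =
      (case i of 0 \<Rightarrow> 0 | Suc j \<Rightarrow> 2 * coeff (gegenbauer_poly 1 (Suc m)) j)
      - coeff (gegenbauer_poly 1 m) i"
    unfolding gegenbauer_poly_1_rec by (cases i) simp_all
  show ?case
  proof (cases "i \<le> Suc (Suc m) \<and> even (m + i)")
    case False
    then show ?thesis unfolding rec by (auto simp: ge2 split: nat.splits)
  next
    case True
    show ?thesis
    proof (cases "i = Suc (Suc m)")
      case True
      then show ?thesis unfolding rec by (simp add: ge2)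
    next
      case False
      with True have "i \<le> m" by (auto simp: le_Suc_eq)
      with True have "even (m - i)" by auto
      then obtain r where r: "m = i + 2 * r"
        using \<open>i \<le> m\<close> by (metis evenE le_add_diff_inverse)
      show ?thesis
        unfolding rec ge2 by (cases i) (simp_all add: r algebra_simps)
    qed
  qed
qed

section \<open>Moments of the weight\<close>

text \<open>
  This is \<open>\<pi> c\<^sup>2 / 4\<close> times \<open>(c / 2)\<^sup>2\<^sup>k\<close> times the \<open>k\<close>-th Catalan number; without the first
  factor it is the moment of order \<open>2k\<close> of Wigner's semicircle distribution of radius \<open>c\<close>.
\<close>
definition cos_moment :: "real \<Rightarrow> nat \<Rightarrow> real" where
  "cos_moment c k = pi / 4 * fact (2 * k) / (fact k * fact (k + 1) * 4 ^ k) * c ^ (2 * k + 2)"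

lemma cos_moment_Suc:
  "cos_moment c (Suc k) = (2 * real k + 1) / (2 * real k + 4) * c\<^sup>2 * cos_moment c k"
  by (simp add: cos_moment_def divide_simps power2_eq_square) (simp add: algebra_simps)

text \<open>
  With \<open>t = cos u\<close>, the case \<open>k = 0\<close> is the area of a quarter disc of radius \<open>c\<close>. The step
  integrates the derivative of \<open>t\<^sup>2\<^sup>k\<^sup>+\<^sup>1 (c\<^sup>2 - t\<^sup>2)\<^sup>3\<^sup>/\<^sup>2\<close>, which is
  \<open>((2k + 1) c\<^sup>2 - (2k + 4) t\<^sup>2) t\<^sup>2\<^sup>k\<close> times the weight: the boundary terms vanish at \<open>t = 0\<close> and
  \<open>t = c\<close>, and this relates the consecutive moments. The antiderivatives are differentiated on
  the open interval only, because at \<open>u = d\<close> the argument of the square root is zero.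
\<close>
lemma has_integral_sqrt_cos_power:
  assumes "0 \<le> d" and "d < pi / 2"
  shows "((\<lambda>u. sqrt ((cos d)\<^sup>2 - (cos u)\<^sup>2) * cos u ^ (2 * k) * sin u)
    has_integral cos_moment (cos d) k) {d..pi / 2}"
proof -
  define c where "c = cos d"
  have c: "c > 0" unfolding c_def using assms by (intro cos_gt_zero_pi) auto
  have interior: "0 < cos u" "cos u < c" if "u \<in> {d<..<pi/2}" for u
    using that assms unfolding c_def by (auto intro!: cos_gt_zero cos_monotone_0_pi)
  have pos: "(cos u)\<^sup>2 < c\<^sup>2" if "u \<in> {d<..<pi/2}" for u
    using interior[OF that] by (intro power_strict_mono) auto
  have closed: "0 \<le> cos u" "cos u \<le> c" if "u \<in> {d..pi/2}" for u
    using that assms unfolding c_def by (auto intro!: cos_ge_zero cos_monotone_0_pi_le)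
  have "((\<lambda>u. sqrt (c\<^sup>2 - (cos u)\<^sup>2) * cos u ^ (2 * k) * sin u)
      has_integral cos_moment c k) {d..pi / 2}"
  proof (induction k)
    case 0
    let ?F = "\<lambda>u. - (cos u * sqrt (c\<^sup>2 - (cos u)\<^sup>2) + c\<^sup>2 * arcsin (cos u / c)) / 2"
    have "((\<lambda>u. sqrt (c\<^sup>2 - (cos u)\<^sup>2) * sin u) has_integral ?F (pi/2) - ?F d) {d..pi / 2}"
    proof (rule fundamental_theorem_of_calculus_interior)
      show "d \<le> pi / 2" using assms by simp
      show "continuous_on {d..pi / 2} ?F"
        using c closed by (intro continuous_intros) (auto simp: divide_simps intro: order_trans[of _ 0])
      fix u assume u: "u \<in> {d<..<pi / 2}"
      define w where "w = sqrt (c\<^sup>2 - (cos u)\<^sup>2)"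
      have w: "w > 0" "w\<^sup>2 = c\<^sup>2 - (cos u)\<^sup>2" using pos[OF u] by (auto simp: w_def)
      have "sqrt (1 - (cos u / c)\<^sup>2) = sqrt ((c\<^sup>2 - (cos u)\<^sup>2) / c\<^sup>2)"
        using c by (simp add: field_simps)
      also have "\<dots> = w / c" using c by (simp add: w_def real_sqrt_divide)
      finally have s: "sqrt (1 - (cos u / c)\<^sup>2) = w / c" .
      have "-1 < cos u / c" "cos u / c < 1" using interior[OF u] c by (auto simp: field_simps)
      then have "(?F has_real_derivative
          - (- sin u * w + cos u * ((2 * cos u * sin u) / (2 * w))
            + c\<^sup>2 * (- sin u / c / (w / c))) / 2) (at u)"
        using pos[OF u] c
        by (auto intro!: derivative_eq_intros simp: s simp flip: w_def) (simp add: divide_simps)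
      also have "- (- sin u * w + cos u * ((2 * cos u * sin u) / (2 * w))
            + c\<^sup>2 * (- sin u / c / (w / c))) / 2 = sin u * (w\<^sup>2 + (c\<^sup>2 - (cos u)\<^sup>2)) / (2 * w)"
        using w(1) c by (simp add: divide_simps) (simp add: algebra_simps power2_eq_square)
      also have "\<dots> = w * sin u"
        using w(1) unfolding w(2)[symmetric] by (simp add: power2_eq_square)
      finally show "(?F has_vector_derivative sqrt (c\<^sup>2 - (cos u)\<^sup>2) * sin u) (at u)"
        by (simp add: has_real_derivative_iff_has_vector_derivative w_def)
    qed
    moreover have "?F (pi/2) - ?F d = cos_moment c 0"
      using c by (simp add: cos_moment_def power2_eq_square flip: c_def)
    ultimately show ?case by simp
  next
    case (Suc k)
    let ?w = "\<lambda>u. sqrt (c\<^sup>2 - (cos u)\<^sup>2)"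
    let ?F = "\<lambda>u. - (cos u ^ (2 * k + 1) * (c\<^sup>2 - (cos u)\<^sup>2) * ?w u)"
    have "((\<lambda>u. ((2 * real k + 1) * c\<^sup>2 - (2 * real k + 4) * (cos u)\<^sup>2)
            * (?w u * cos u ^ (2 * k) * sin u)) has_integral ?F (pi/2) - ?F d) {d..pi / 2}"
    proof (rule fundamental_theorem_of_calculus_interior)
      show "d \<le> pi / 2" using assms by simp
      show "continuous_on {d..pi / 2} ?F"
        by (intro continuous_intros)
      fix u assume u: "u \<in> {d<..<pi / 2}"
      define w where "w = ?w u"
      have w: "w > 0" "w\<^sup>2 = c\<^sup>2 - (cos u)\<^sup>2" using pos[OF u] by (auto simp: w_def)
      have "((\<lambda>u. cos u ^ (2 * k + 1)) has_real_derivative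
          (2 * real k + 1) * cos u ^ (2 * k) * (- sin u)) (at u)"
        using DERIV_power[OF DERIV_cos, of "2 * k + 1" u] by (simp add: algebra_simps)
      moreover have "((\<lambda>u. c\<^sup>2 - (cos u)\<^sup>2) has_real_derivative 2 * cos u * sin u) (at u)"
        by (auto intro!: derivative_eq_intros)
      moreover have "(?w has_real_derivative (2 * cos u * sin u) / (2 * w)) (at u)"
        using pos[OF u] by (auto intro!: derivative_eq_intros simp: w_def field_simps)
      ultimately have "(?F has_real_derivative
          - (((2 * real k + 1) * cos u ^ (2 * k) * (- sin u) * w\<^sup>2
             + cos u ^ (2 * k + 1) * (2 * cos u * sin u)) * w
             + cos u ^ (2 * k + 1) * w\<^sup>2 * ((2 * cos u * sin u) / (2 * w)))) (at u)"
        unfolding w(2)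
        by (intro DERIV_minus[OF DERIV_mult[OF DERIV_mult], THEN DERIV_cong])
           (auto simp: algebra_simps simp flip: w_def)
      also have "- (((2 * real k + 1) * cos u ^ (2 * k) * (- sin u) * w\<^sup>2
             + cos u ^ (2 * k + 1) * (2 * cos u * sin u)) * w
             + cos u ^ (2 * k + 1) * w\<^sup>2 * ((2 * cos u * sin u) / (2 * w)))
          = ((2 * real k + 1) * w\<^sup>2 - 3 * (cos u)\<^sup>2) * (w * cos u ^ (2 * k) * sin u)"
        using w(1) by (simp add: power2_eq_square algebra_simps)
      also have "\<dots> = ((2 * real k + 1) * c\<^sup>2 - (2 * real k + 4) * (cos u)\<^sup>2)
            * (w * cos u ^ (2 * k) * sin u)"
        unfolding w(2) by (simp add: algebra_simps)
      finally show "(?F has_vector_derivative ((2 * real k + 1) * c\<^sup>2 - (2 * real k + 4) * (cos u)\<^sup>2)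
            * (?w u * cos u ^ (2 * k) * sin u)) (at u)"
        by (simp add: has_real_derivative_iff_has_vector_derivative w_def)
    qed
    moreover have "?F (pi/2) - ?F d = 0" by (simp add: c_def)
    ultimately have "((\<lambda>u. ((2 * real k + 1) * c\<^sup>2 - (2 * real k + 4) * (cos u)\<^sup>2)
            * (?w u * cos u ^ (2 * k) * sin u)) has_integral 0) {d..pi / 2}"
      by (simp only:)
    from has_integral_diff[OF has_integral_mult_right[OF Suc, of "(2 * real k + 1) * c\<^sup>2"] this]
    have "((\<lambda>u. (2 * real k + 4) * (?w u * cos u ^ (2 * Suc k) * sin u))
        has_integral (2 * real k + 1) * c\<^sup>2 * cos_moment c k) {d..pi / 2}"
      by (simp add: algebra_simps power2_eq_square)
    from has_integral_mult_right[OF this, of "1 / (2 * real k + 4)"] show ?case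
      by (simp add: cos_moment_Suc add_nonneg_eq_0_iff)
  qed
  then show ?thesis by (simp add: c_def)
qed

section \<open>The Jacobi polynomial expanded at -1\<close>

text \<open>
  The defining sum is homogeneous of degree \<open>l\<close> in \<open>y - 1\<close> and \<open>y\<close>. Expanding \<open>(y - 1)\<^sup>s\<close> and
  collecting the power \<open>y\<^sup>l\<^sup>-\<^sup>j\<close> leaves a sum over \<open>s\<close> of three binomial coefficients. Trinomial
  revision moves the factor \<open>(l + b gchoose j)\<close>, independent of \<open>s\<close>, out of it, and Vandermonde's
  convolution evaluates the rest.
\<close>
lemma poly_jacobi_poly_expansion:
  fixes a b y :: real
  shows "poly (jacobi_poly a b l) (2 * y - 1) =
    (\<Sum>k\<le>l. (-1) ^ (l - k) * ((real l + b) gchoose (l - k))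
             * ((real l + a + b + real k) gchoose k) * y ^ k)"
proof -
  let ?A = "real l + a" and ?B = "real l + b"
  have base: "poly [:- (1/2), 1/2:] (2 * y - 1) = y - 1" "poly [:1/2, 1/2:] (2 * y - 1) = y"
    by (simp_all add: field_simps)
  have "poly (jacobi_poly a b l) (2 * y - 1) =
      (\<Sum>s\<le>l. (?A gchoose (l - s)) * (?B gchoose s) * ((y - 1) ^ s * y ^ (l - s)))"
    unfolding jacobi_poly_def poly_sum
    by (intro sum.cong refl) (simp add: poly_power base del: poly_pCons)
  also have "\<dots> = (\<Sum>s\<le>l. \<Sum>j\<le>s. (?A gchoose (l - s)) * (?B gchoose s)
      * (real (s choose j) * (-1) ^ j * y ^ (l - j)))"
  proof (intro sum.cong refl)
    fix s assume s: "s \<in> {..l}"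
    have "(y - 1) ^ s * y ^ (l - s) = (\<Sum>j\<le>s. real (s choose j) * (-1) ^ j * y ^ (s - j) * y ^ (l - s))"
      using binomial_ring[of "-1" y s] by (simp add: sum_distrib_right)
    also have "\<dots> = (\<Sum>j\<le>s. real (s choose j) * (-1) ^ j * y ^ (l - j))"
      using s by (intro sum.cong refl) (simp add: mult.assoc flip: power_add)
    finally show "(?A gchoose (l - s)) * (?B gchoose s) * ((y - 1) ^ s * y ^ (l - s)) =
        (\<Sum>j\<le>s. (?A gchoose (l - s)) * (?B gchoose s) * (real (s choose j) * (-1) ^ j * y ^ (l - j)))"
      by (simp add: sum_distrib_left)
  qed
  also have "\<dots> = (\<Sum>j\<le>l. \<Sum>s=j..l. (?A gchoose (l - s)) * (?B gchoose s)
      * (real (s choose j) * (-1) ^ j * y ^ (l - j)))"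
    by (simp only: sum.Sigma finite_atMost finite_atLeastAtMost ball_triv simp_thms)
       (rule sum.reindex_bij_witness[of _ prod.swap prod.swap]; auto)
  also have "\<dots> = (\<Sum>j\<le>l. (-1) ^ j * (?B gchoose j) * ((?A + ?B - real j) gchoose (l - j)) * y ^ (l - j))"
  proof (intro sum.cong refl)
    fix j assume "j \<in> {..l}"
    then have j: "j \<le> l" by simp
    have "(\<Sum>s=j..l. (?A gchoose (l - s)) * (?B gchoose s) * real (s choose j))
        = (\<Sum>s=j..l. (?B gchoose j) * ((?A gchoose (l - s)) * ((?B - real j) gchoose (s - j))))"
    proof (intro sum.cong refl)
      fix s assume "s \<in> {j..l}"
      then have "(?B gchoose s) * real (s choose j) = (?B gchoose j) * ((?B - real j) gchoose (s - j))"
        using gbinomial_trinomial_revision[of j s ?B] by (simp add: binomial_gbinomial)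
      then show "(?A gchoose (l - s)) * (?B gchoose s) * real (s choose j)
          = (?B gchoose j) * ((?A gchoose (l - s)) * ((?B - real j) gchoose (s - j)))"
        by (simp add: mult.assoc mult.left_commute)
    qed
    also have "\<dots> = (?B gchoose j) * (\<Sum>r\<le>l - j. ((?B - real j) gchoose r) * (?A gchoose (l - j - r)))"
      unfolding sum_distrib_left
      by (rule sum.reindex_bij_witness[of _ "\<lambda>r. r + j" "\<lambda>s. s - j"]) (use j in \<open>auto simp: mult_ac\<close>)
    also have "\<dots> = (?B gchoose j) * ((?A + ?B - real j) gchoose (l - j))"
      unfolding atMost_atLeast0 gbinomial_Vandermonde by (simp add: algebra_simps)
    finally have inner: "(\<Sum>s=j..l. (?A gchoose (l - s)) * (?B gchoose s) * real (s choose j)) = \<dots>" .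
    show "(\<Sum>s=j..l. (?A gchoose (l - s)) * (?B gchoose s) * (real (s choose j) * (-1) ^ j * y ^ (l - j)))
        = (-1) ^ j * (?B gchoose j) * ((?A + ?B - real j) gchoose (l - j)) * y ^ (l - j)"
      unfolding mult.assoc[symmetric] sum_distrib_right[symmetric] inner by (simp only: mult_ac)
  qed
  also have "\<dots> = (\<Sum>k\<le>l. (-1) ^ (l - k) * (?B gchoose (l - k))
             * ((real l + a + b + real k) gchoose k) * y ^ k)"
    by (rule sum.reindex_bij_witness[of _ "\<lambda>k. l - k" "\<lambda>j. l - j"]) (auto simp: of_nat_diff algebra_simps)
  finally show ?thesis .
qed

section \<open>Evaluation of the integral\<close>

lemma poly_even:
  assumes "\<And>i. coeff q i \<noteq> 0 \<Longrightarrow> even i \<and> i \<le> 2 * l"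
  shows "poly q (x::real) = (\<Sum>k\<le>l. coeff q (2 * k) * x ^ (2 * k))"
proof -
  have "degree q \<le> 2 * l" using assms by (intro degree_le) (meson not_le)
  then have "poly q x = (\<Sum>i\<le>2 * l. coeff q i * x ^ i)"
    using arg_cong[OF poly_as_sum_of_monoms', of q "2 * l" "\<lambda>p. poly p x"]
    by (simp add: poly_sum poly_monom)
  also have "\<dots> = (\<Sum>i\<in>(\<lambda>k. 2 * k) ` {..l}. coeff q i * x ^ i)"
    by (rule sum.mono_neutral_right) (use assms in \<open>force elim!: evenE\<close>)+
  also have "\<dots> = (\<Sum>k\<le>l. coeff q (2 * k) * x ^ (2 * k))"
    by (subst sum.reindex) (auto simp: inj_on_def)
  finally show ?thesis .
qed

text \<open>
  The factor \<open>(2n + 2k)! / (2k)!\<close> from differentiating cancels the factorial \<open>(2n + 2k)!\<close> in the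
  binomial coefficient, so that only \<open>(2k)!\<close> is left, the numerator of the moment of order \<open>k\<close>.
\<close>
lemma coeff_higher_pderiv_gegenbauer_poly_1:
  assumes "k \<le> l"
  shows "coeff ((pderiv ^^ (2 * n)) (gegenbauer_poly 1 (2 * l + 2 * n))) (2 * k) =
    (-1) ^ (l - k) * 2 ^ (2 * n + 2 * k) * fact (l + 2 * n + k) / (fact (l - k) * fact (2 * k))"
proof -
  have "(2 * l + 2 * n - (2 * k + 2 * n)) div 2 = l - k"
    "(2 * l + 2 * n + (2 * k + 2 * n)) div 2 = l + 2 * n + k"
    by auto
  then have "coeff (gegenbauer_poly 1 (2 * l + 2 * n)) (2 * k + 2 * n)
      = (-1) ^ (l - k) * 2 ^ (2 * n + 2 * k) * real ((l + 2 * n + k) choose (l - k))"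
    unfolding coeff_gegenbauer_poly_1 using assms by (simp add: ac_simps)
  moreover have "real ((l + 2 * n + k) choose (l - k)) = fact (l + 2 * n + k) / (fact (l - k) * fact (2 * n + 2 * k))"
    using assms by (subst binomial_fact) (auto simp: algebra_simps)
  moreover have "pochhammer (1 + real (2 * k)) (2 * n) = fact (2 * n + 2 * k) / fact (2 * k)"
    using pochhammer_product'[of "1 :: real" "2 * k" "2 * n"]
    by (simp add: field_simps flip: pochhammer_fact)
  ultimately show ?thesis
    by (simp add: coeff_higher_pderiv mult_ac)
qed

theorem mainTheorem2:
  fixes n l :: nat and d :: real
  assumes "n \<ge> 1" and "0 \<le> d" and "d < pi / 2"
  shows "((\<lambda>u. sqrt ((cos d)\<^sup>2 - (cos u)\<^sup>2) / (cos d)\<^sup>2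
              * (L_op ^^ (2 * n)) (\<lambda>v. poly (gegenbauer_poly 1 (2 * l + 2 * n)) (cos v)) u
              * sin u)
          has_integral
            (2 ^ (2 * n - 2) * pi * fact (l + 2 * n) / fact (l + 1)
              * poly (jacobi_poly (2 * real n - 1) 1 l) (cos (2 * d)))) {d..pi / 2}"
proof -
  define c where "c = cos d"
  define q where "q = (pderiv ^^ (2 * n)) (gegenbauer_poly 1 (2 * l + 2 * n))"
  have c: "c > 0" unfolding c_def using assms by (intro cos_gt_zero_pi) auto
  have even_q: "even i \<and> i \<le> 2 * l" if "coeff q i \<noteq> 0" for i
    using that by (auto simp: q_def coeff_higher_pderiv coeff_gegenbauer_poly_1 split: if_splits)
  have poly_q: "poly q x = (\<Sum>k\<le>l. coeff q (2 * k) * x ^ (2 * k))" for x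
    by (rule poly_even) (use even_q in blast)
  have "((\<lambda>u. \<Sum>k\<le>l. coeff q (2 * k) / c\<^sup>2 * (sqrt (c\<^sup>2 - (cos u)\<^sup>2) * cos u ^ (2 * k) * sin u))
      has_integral (\<Sum>k\<le>l. coeff q (2 * k) / c\<^sup>2 * cos_moment c k)) {d..pi / 2}"
    unfolding c_def using assms
    by (intro has_integral_sum finite_atMost has_integral_mult_right has_integral_sqrt_cos_power)
  moreover have "(\<Sum>k\<le>l. coeff q (2 * k) / c\<^sup>2 * (sqrt (c\<^sup>2 - (cos u)\<^sup>2) * cos u ^ (2 * k) * sin u))
      = sqrt (c\<^sup>2 - (cos u)\<^sup>2) / c\<^sup>2 * poly q (cos u) * sin u" for u
    unfolding poly_q by (simp add: sum_distrib_left sum_distrib_right sum_divide_distrib mult_ac)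
  moreover have "(\<Sum>k\<le>l. coeff q (2 * k) / c\<^sup>2 * cos_moment c k)
      = 2 ^ (2 * n - 2) * pi * fact (l + 2 * n) / fact (l + 1)
          * poly (jacobi_poly (2 * real n - 1) 1 l) (2 * c\<^sup>2 - 1)"
    unfolding poly_jacobi_poly_expansion sum_distrib_left
  proof (intro sum.cong refl)
    fix k assume "k \<in> {..l}"
    then have k: "k \<le> l" by simp
    have "((real l + 1) gchoose (l - k)) = real ((l + 1) choose (l - k))"
      by (simp add: binomial_gbinomial add.commute)
    also have "\<dots> = fact (l + 1) / (fact (l - k) * fact (k + 1))"
      using k by (subst binomial_fact) (auto simp: Suc_diff_le)
    finally have b1: "((real l + 1) gchoose (l - k)) = fact (l + 1) / (fact (l - k) * fact (k + 1))" .
    have "((real l + (2 * real n - 1) + 1 + real k) gchoose k) = real ((l + 2 * n + k) choose k)"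
      by (simp add: binomial_gbinomial)
    also have "\<dots> = fact (l + 2 * n + k) / (fact k * fact (l + 2 * n))"
      by (subst binomial_fact) auto
    finally have b2: "((real l + (2 * real n - 1) + 1 + real k) gchoose k)
        = fact (l + 2 * n + k) / (fact k * fact (l + 2 * n))" .
    have p2: "(2::real) ^ (2 * n + 2 * k) = 4 * 2 ^ (2 * n - 2) * 4 ^ k"
    proof -
      \<comment> \<open>\<open>2 * n - 2\<close> is a subtraction of natural numbers, exact because \<open>n \<ge> 1\<close>\<close>
      have "2 * n + 2 * k = 2 + (2 * n - 2) + 2 * k" using assms(1) by simp
      then show ?thesis by (simp only: power_add power_mult) simp
    qed
    have pc: "c ^ (2 * k + 2) = c\<^sup>2 * (c\<^sup>2) ^ k"
      by (simp add: power_add power_mult power2_eq_square)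
    show "coeff q (2 * k) / c\<^sup>2 * cos_moment c k
        = 2 ^ (2 * n - 2) * pi * fact (l + 2 * n) / fact (l + 1)
          * ((-1) ^ (l - k) * ((real l + 1) gchoose (l - k))
             * ((real l + (2 * real n - 1) + 1 + real k) gchoose k) * (c\<^sup>2) ^ k)"
      unfolding q_def coeff_higher_pderiv_gegenbauer_poly_1[OF k] cos_moment_def b1 b2 p2 pc
      using c by (simp del: fact_Suc add: divide_simps)
  qed
  moreover have "cos (2 * d) = 2 * c\<^sup>2 - 1"
    by (simp add: c_def cos_double_cos)
  ultimately show ?thesis
    unfolding funpow_L_op_poly_cos c_def[symmetric] q_def[symmetric] by simp
qed

end
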